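(* Let $A_1,\ldots,A_r$ be any subgroups of a group $G$, with join $J=\big\langle\bigcup_{i=1}^r A_i\big\rangle$. Then in the HNN-extension $G*_{A_1,\ldots,A_r}(t_1,\ldots,t_r)$ we have $$G\cap\Big\langle\bigcup_{i=1}^r G^{t_i}\Big\rangle=J.$$
   Context: Notation: $x^y=y^{-1}xy$ and $G^y=y^{-1}Gy$. For subgroups $A_1,\ldots,A_r\le G$, $G*_{A_1,\ldots,A_r}(t_1,\ldots,t_r)$ denotes the multiple HNN-extension $\langle G,t_1,\ldots,t_r\mid a^{t_i}=a\text{ for all }a\in A_i,\ i=1,\ldots,r\rangle$. The group $G$ is identified with its natural image in it. *)

theory Defs
  imports "HOL-Algebra.Generated_Groups"
begin

text \<open>
  A word over a set \<open>X\<close> of generators is a list of signed letters: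
  \<open>(x, True)\<close> stands for \<open>x\<close> and \<open>(x, False)\<close> for the formal inverse of \<open>x\<close>.
\<close>

type_synonym 'x group_word = "('x \<times> bool) list"

definition group_words :: "'x set \<Rightarrow> 'x group_word set"
  where "group_words X = lists (X \<times> UNIV)"

abbreviation pos :: "'x \<Rightarrow> 'x \<times> bool" where "pos x \<equiv> (x, True)"
abbreviation neg :: "'x \<Rightarrow> 'x \<times> bool" where "neg x \<equiv> (x, False)"

text \<open>
  A pair \<open>(u, v) \<in> R\<close> is the defining relation \<open>u = v\<close>.  The group with presentation
  \<open>\<langle>X | R\<rangle>\<close> is the quotient of the monoid of words by the least congruence that cancels
  inverse letters and contains \<open>R\<close>.
\<close>

inductive pres_cong :: "'x set \<Rightarrow> ('x group_word \<times> 'x group_word) set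
    \<Rightarrow> 'x group_word \<Rightarrow> 'x group_word \<Rightarrow> bool"
  for X :: "'x set" and R :: "('x group_word \<times> 'x group_word) set"
where
  refl: "w \<in> group_words X \<Longrightarrow> pres_cong X R w w"
| sym: "pres_cong X R u v \<Longrightarrow> pres_cong X R v u"
| trans: "pres_cong X R u v \<Longrightarrow> pres_cong X R v w \<Longrightarrow> pres_cong X R u w"
| append: "pres_cong X R u u' \<Longrightarrow> pres_cong X R v v' \<Longrightarrow> pres_cong X R (u @ v) (u' @ v')"
| cancel: "x \<in> X \<Longrightarrow> pres_cong X R [(x, b), (x, \<not> b)] []"
| relation: "(u, v) \<in> R \<Longrightarrow> u \<in> group_words X \<Longrightarrow> v \<in> group_words X \<Longrightarrow> pres_cong X R u v"

definition pres_rel :: "'x set \<Rightarrow> ('x group_word \<times> 'x group_word) set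
    \<Rightarrow> ('x group_word \<times> 'x group_word) set"
  where "pres_rel X R = {(u, v). pres_cong X R u v}"

definition pres_class :: "'x set \<Rightarrow> ('x group_word \<times> 'x group_word) set
    \<Rightarrow> 'x group_word \<Rightarrow> 'x group_word set"
  where "pres_class X R w = pres_rel X R `` {w}"

definition presented_group :: "'x set \<Rightarrow> ('x group_word \<times> 'x group_word) set
    \<Rightarrow> 'x group_word set monoid"
  where "presented_group X R =
    \<lparr>carrier = group_words X // pres_rel X R,
     mult = (\<lambda>P Q. \<Union>u\<in>P. \<Union>v\<in>Q. pres_class X R (u @ v)),
     one = pres_class X R []\<rparr>"

text \<open>
  The multiple HNN-extension with all associated isomorphisms trivial, for a family
  \<open>A\<close> of subgroups indexed by \<open>I\<close>: generators are the elements of \<open>G\<close> and the stable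
  letters \<open>t\<^sub>i\<close>; relations are the multiplication table of \<open>G\<close> and
  \<open>t\<^sub>i\<inverse> a t\<^sub>i = a\<close> for \<open>a \<in> A i\<close>.
\<close>

definition hnn_gens :: "('a, 'm) monoid_scheme \<Rightarrow> 'i set \<Rightarrow> ('a + 'i) set"
  where "hnn_gens G I = Inl ` carrier G \<union> Inr ` I"

definition hnn_rels :: "('a, 'm) monoid_scheme \<Rightarrow> 'i set \<Rightarrow> ('i \<Rightarrow> 'a set)
    \<Rightarrow> (('a + 'i) group_word \<times> ('a + 'i) group_word) set"
  where "hnn_rels G I A =
    {([pos (Inl g), pos (Inl h)], [pos (Inl (g \<otimes>\<^bsub>G\<^esub> h))]) | g h. g \<in> carrier G \<and> h \<in> carrier G} \<union>
    {([neg (Inr i), pos (Inl a), pos (Inr i)], [pos (Inl a)]) | i a. i \<in> I \<and> a \<in> A i}"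

definition hnn_extension :: "('a, 'm) monoid_scheme \<Rightarrow> 'i set \<Rightarrow> ('i \<Rightarrow> 'a set)
    \<Rightarrow> ('a + 'i) group_word set monoid"
  where "hnn_extension G I A = presented_group (hnn_gens G I) (hnn_rels G I A)"

definition hnn_base :: "('a, 'm) monoid_scheme \<Rightarrow> 'i set \<Rightarrow> ('i \<Rightarrow> 'a set)
    \<Rightarrow> 'a \<Rightarrow> ('a + 'i) group_word set"
  where "hnn_base G I A g = pres_class (hnn_gens G I) (hnn_rels G I A) [pos (Inl g)]"

definition hnn_stable :: "('a, 'm) monoid_scheme \<Rightarrow> 'i set \<Rightarrow> ('i \<Rightarrow> 'a set)
    \<Rightarrow> 'i \<Rightarrow> ('a + 'i) group_word set"
  where "hnn_stable G I A i = pres_class (hnn_gens G I) (hnn_rels G I A) [pos (Inr i)]"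

definition conj_set :: "('a, 'm) monoid_scheme \<Rightarrow> 'a set \<Rightarrow> 'a \<Rightarrow> 'a set"
  where "conj_set H S y = (\<lambda>x. inv\<^bsub>H\<^esub> y \<otimes>\<^bsub>H\<^esub> x \<otimes>\<^bsub>H\<^esub> y) ` S"


lemma pres_cong_words: "pres_cong X R u v \<Longrightarrow> u \<in> group_words X \<and> v \<in> group_words X"
  by (induction rule: pres_cong.induct) (auto simp: group_words_def)

lemma equiv_pres_rel: "equiv (group_words X) (pres_rel X R)"
proof (rule equivI)
  show "pres_rel X R \<subseteq> group_words X \<times> group_words X"
    using pres_cong_words by (force simp: pres_rel_def)
  show "refl_on (group_words X) (pres_rel X R)"
    by (auto simp: refl_on_def pres_rel_def intro: pres_cong.refl)
  show "sym (pres_rel X R)"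
    by (auto simp: sym_def pres_rel_def intro: pres_cong.sym)
  show "trans (pres_rel X R)"
    by (auto simp: trans_def pres_rel_def intro: pres_cong.trans)
qed

lemma pres_class_eq_iff:
  assumes "u \<in> group_words X" "v \<in> group_words X"
  shows "pres_class X R u = pres_class X R v \<longleftrightarrow> pres_cong X R u v"
  using eq_equiv_class_iff[OF equiv_pres_rel assms]
  by (simp add: pres_class_def pres_rel_def)

lemma carrier_presented_group:
  "carrier (presented_group X R) = pres_class X R ` group_words X"
  by (auto simp: presented_group_def quotient_def pres_class_def)

lemma one_presented_group: "\<one>\<^bsub>presented_group X R\<^esub> = pres_class X R []"
  by (simp add: presented_group_def)

lemma append_group_words:
  "u \<in> group_words X \<Longrightarrow> v \<in> group_words X \<Longrightarrow> u @ v \<in> group_words X"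
  by (auto simp: group_words_def)

lemma mult_presented_group:
  assumes "u \<in> group_words X" "v \<in> group_words X"
  shows "pres_class X R u \<otimes>\<^bsub>presented_group X R\<^esub> pres_class X R v = pres_class X R (u @ v)"
proof -
  have "pres_class X R (u' @ v') = pres_class X R (u @ v)"
    if "u' \<in> pres_class X R u" "v' \<in> pres_class X R v" for u' v'
  proof -
    have "pres_cong X R u u'" "pres_cong X R v v'"
      using that by (auto simp: pres_class_def pres_rel_def)
    then show ?thesis
      using pres_cong_words by (metis append_group_words pres_class_eq_iff pres_cong.append)
  qed
  moreover have "u \<in> pres_class X R u" "v \<in> pres_class X R v"
    using assms by (auto simp: pres_class_def pres_rel_def intro: pres_cong.refl)
  ultimately have "(\<Union>u'\<in>pres_class X R u. \<Union>v'\<in>pres_class X R v. pres_class X R (u' @ v'))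
      = pres_class X R (u @ v)"
    by blast
  then show ?thesis
    by (simp add: presented_group_def)
qed

definition inv_word :: "'x group_word \<Rightarrow> 'x group_word"
  where "inv_word w = rev (map (\<lambda>(x, b). (x, \<not> b)) w)"

lemma inv_word_group_words: "w \<in> group_words X \<Longrightarrow> inv_word w \<in> group_words X"
  by (auto simp: group_words_def inv_word_def)

lemma inv_word_cancel:
  assumes "w \<in> group_words X"
  shows "pres_cong X R (inv_word w @ w) []"
  using assms
proof (induction w)
  case Nil
  then show ?case by (auto simp: inv_word_def group_words_def intro: pres_cong.refl)
next
  case (Cons p w)
  obtain x b where p: "p = (x, b)" by fastforce
  have x: "x \<in> X" and w: "w \<in> group_words X"
    using Cons.prems by (auto simp: group_words_def p)
  have "pres_cong X R [(x, \<not> b), (x, b)] []"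
    using pres_cong.cancel[OF x, of R "\<not> b"] by simp
  then have "pres_cong X R ([(x, \<not> b), (x, b)] @ w) ([] @ w)"
    using w by (intro pres_cong.append pres_cong.refl)
  then have "pres_cong X R (inv_word w @ [(x, \<not> b), (x, b)] @ w) (inv_word w @ w)"
    using inv_word_group_words[OF w] by (auto intro: pres_cong.append pres_cong.refl)
  then have "pres_cong X R (inv_word w @ [(x, \<not> b), (x, b)] @ w) []"
    using Cons.IH[OF w] by (rule pres_cong.trans)
  then show ?case by (simp add: inv_word_def p)
qed

lemma group_presented_group: "group (presented_group X R)"
proof (rule groupI)
  let ?H = "presented_group X R"
  have nil: "[] \<in> group_words X" by (simp add: group_words_def)
  have class_carrier: "pres_class X R w \<in> carrier ?H" if "w \<in> group_words X" for w
    using that unfolding carrier_presented_group by (rule imageI)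
  show "\<one>\<^bsub>?H\<^esub> \<in> carrier ?H"
    unfolding one_presented_group using nil by (rule class_carrier)
  fix P assume "P \<in> carrier ?H"
  then obtain u where u: "u \<in> group_words X" "P = pres_class X R u"
    unfolding carrier_presented_group by blast
  show "\<one>\<^bsub>?H\<^esub> \<otimes>\<^bsub>?H\<^esub> P = P"
    using u nil by (simp add: one_presented_group mult_presented_group)
  show "\<exists>Q\<in>carrier ?H. Q \<otimes>\<^bsub>?H\<^esub> P = \<one>\<^bsub>?H\<^esub>"
  proof
    have i: "inv_word u \<in> group_words X" using u(1) by (rule inv_word_group_words)
    then show "pres_class X R (inv_word u) \<in> carrier ?H" by (rule class_carrier)
    have "pres_class X R (inv_word u @ u) = pres_class X R []"
      using inv_word_cancel[OF u(1)] pres_class_eq_iff[OF append_group_words[OF i u(1)] nil]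
      by blast
    then show "pres_class X R (inv_word u) \<otimes>\<^bsub>?H\<^esub> P = \<one>\<^bsub>?H\<^esub>"
      unfolding u(2) one_presented_group mult_presented_group[OF i u(1)] .
  qed
  fix Q assume "Q \<in> carrier ?H"
  then obtain v where v: "v \<in> group_words X" "Q = pres_class X R v"
    unfolding carrier_presented_group by blast
  show "P \<otimes>\<^bsub>?H\<^esub> Q \<in> carrier ?H"
    unfolding u(2) v(2) mult_presented_group[OF u(1) v(1)]
    by (rule class_carrier[OF append_group_words[OF u(1) v(1)]])
  fix T assume "T \<in> carrier ?H"
  then obtain w where w: "w \<in> group_words X" "T = pres_class X R w"
    unfolding carrier_presented_group by blast
  show "P \<otimes>\<^bsub>?H\<^esub> Q \<otimes>\<^bsub>?H\<^esub> T = P \<otimes>\<^bsub>?H\<^esub> (Q \<otimes>\<^bsub>?H\<^esub> T)"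
    using u v w by (simp add: mult_presented_group append_group_words)
qed

lemma group_hnn_extension: "group (hnn_extension G I A)"
  by (simp add: hnn_extension_def group_presented_group)

lemma hnn_base_hom:
  assumes "group G"
  shows "hnn_base G I A \<in> hom G (hnn_extension G I A)"
proof (rule homI)
  interpret group G by fact
  let ?X = "hnn_gens G I" and ?R = "hnn_rels G I A"
  have base: "[pos (Inl k)] \<in> group_words ?X" if "k \<in> carrier G" for k
    using that by (simp add: group_words_def hnn_gens_def)
  fix g assume g: "g \<in> carrier G"
  show "hnn_base G I A g \<in> carrier (hnn_extension G I A)"
    unfolding hnn_base_def hnn_extension_def carrier_presented_group
    by (rule imageI[OF base[OF g]])
  fix h assume h: "h \<in> carrier G"
  have w: "[pos (Inl g), pos (Inl h)] \<in> group_words ?X"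
    using g h by (simp add: group_words_def hnn_gens_def)
  have gh: "[pos (Inl (g \<otimes>\<^bsub>G\<^esub> h))] \<in> group_words ?X"
    using g h by (intro base m_closed)
  have "([pos (Inl g), pos (Inl h)], [pos (Inl (g \<otimes>\<^bsub>G\<^esub> h))]) \<in> ?R"
    using g h unfolding hnn_rels_def by blast
  then have "pres_cong ?X ?R [pos (Inl g), pos (Inl h)] [pos (Inl (g \<otimes>\<^bsub>G\<^esub> h))]"
    using w gh by (rule pres_cong.relation)
  then have "pres_class ?X ?R [pos (Inl g), pos (Inl h)] = pres_class ?X ?R [pos (Inl (g \<otimes>\<^bsub>G\<^esub> h))]"
    using pres_class_eq_iff[OF w gh] by blast
  then show "hnn_base G I A (g \<otimes>\<^bsub>G\<^esub> h) =
      hnn_base G I A g \<otimes>\<^bsub>hnn_extension G I A\<^esub> hnn_base G I A h"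
    unfolding hnn_base_def hnn_extension_def mult_presented_group[OF base[OF g] base[OF h]]
    by simp
qed

text \<open>Killing the stable letters retracts the HNN-extension onto \<open>G\<close>, so \<open>G\<close> embeds.\<close>

fun hnn_retract :: "('a, 'm) monoid_scheme \<Rightarrow> ('a + 'i) group_word \<Rightarrow> 'a"
where
  "hnn_retract G [] = \<one>\<^bsub>G\<^esub>"
| "hnn_retract G ((Inl g, b) # w) = (if b then g else inv\<^bsub>G\<^esub> g) \<otimes>\<^bsub>G\<^esub> hnn_retract G w"
| "hnn_retract G ((Inr i, b) # w) = hnn_retract G w"

lemma inj_on_hnn_base:
  assumes "group G"
  shows "inj_on (hnn_base G I A) (carrier G)"
proof (rule inj_onI)
  interpret group G by fact
  let ?X = "hnn_gens G I" and ?R = "hnn_rels G I A"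
  have closed: "hnn_retract G w \<in> carrier G" if "w \<in> group_words ?X" for w
    using that
  proof (induction w)
    case (Cons p w)
    obtain x b where "p = (x, b)" by fastforce
    with Cons show ?case
      by (cases x) (auto simp: group_words_def hnn_gens_def)
  qed simp
  have app: "hnn_retract G (u @ v) = hnn_retract G u \<otimes>\<^bsub>G\<^esub> hnn_retract G v"
    if "u \<in> group_words ?X" "v \<in> group_words ?X" for u v
    using that closed[of v]
  proof (induction u)
    case (Cons p u)
    obtain x b where p: "p = (x, b)" by fastforce
    have u: "u \<in> group_words ?X" using Cons.prems by (auto simp: group_words_def)
    show ?case
      using Cons closed[OF u] u
      by (cases x) (auto simp: p group_words_def hnn_gens_def m_assoc)
  qed simp
  have inv: "hnn_retract G u = hnn_retract G v" if "pres_cong ?X ?R u v" for u v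
    using that
  proof (induction rule: pres_cong.induct)
    case (append u u' v v')
    then show ?case using app pres_cong_words by metis
  next
    case (cancel x b)
    then show ?case by (auto simp: hnn_gens_def)
  next
    case (relation u v)
    then show ?case by (auto simp: hnn_rels_def hnn_gens_def group_words_def)
  qed auto
  fix g h assume gh: "g \<in> carrier G" "h \<in> carrier G" "hnn_base G I A g = hnn_base G I A h"
  then have "pres_cong ?X ?R [pos (Inl g)] [pos (Inl h)]"
    by (subst pres_class_eq_iff[symmetric]) (auto simp: hnn_base_def group_words_def hnn_gens_def)
  from inv[OF this] show "g = h" using gh by simp
qed

end

theory Submission
  imports Defs "HOL-Algebra.Group_Action" "HOL-Combinatorics.Transposition"
begin

text \<open>
  The inclusion of \<open>J\<close> is immediate, since every \<open>a \<in> A i\<close> equals its own conjugate by \<open>t i\<close>.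
  For the converse it suffices to exhibit one action of the extension and one point whose
  stabilizer contains every conjugate of \<open>G\<close> by a \<open>t i\<close> but meets \<open>G\<close> exactly in \<open>J\<close>.

  Let \<open>G\<close> act by left translation on the subsets of its carrier.  The point \<open>J\<close> has stabilizer
  \<open>J\<close> (lemma \<open>stabilizer_left_translation\<close>), and the point \<open>{}\<close> is fixed by all of \<open>G\<close>.  Let
  every stable letter act as the transposition of \<open>J\<close> and \<open>{}\<close>.  Elements of \<open>A i \<subseteq> J\<close> fix both
  points, so they commute with this transposition; the defining relations therefore hold, and by
  the universal property (lemma \<open>hnn_extension_universal\<close>) the whole extension acts.  Now \<open>t i\<close>
  moves \<open>J\<close> to a point fixed by \<open>G\<close>, so the conjugate of \<open>G\<close> by \<open>t i\<close> fixes \<open>J\<close>.  Hence the subgroup that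
  these conjugates generate fixes \<open>J\<close>, and any element of \<open>G\<close> in it lies in the stabilizer \<open>J\<close>.
\<close>

section \<open>Universal properties\<close>

fun eval_word :: "('b, 'm) monoid_scheme \<Rightarrow> ('x \<Rightarrow> 'b) \<Rightarrow> 'x group_word \<Rightarrow> 'b"
where
  "eval_word L f [] = \<one>\<^bsub>L\<^esub>"
| "eval_word L f ((x, b) # w) = (if b then f x else inv\<^bsub>L\<^esub> f x) \<otimes>\<^bsub>L\<^esub> eval_word L f w"

context group
begin

lemma eval_word_closed:
  assumes "f \<in> X \<rightarrow> carrier G" "w \<in> group_words X"
  shows "eval_word G f w \<in> carrier G"
  using assms(2)
proof (induction w)
  case (Cons p w)
  then show ?case
    using assms(1) by (cases p) (auto simp: group_words_def)
qed simp

lemma eval_word_append: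
  assumes f: "f \<in> X \<rightarrow> carrier G" and "u \<in> group_words X" and v: "v \<in> group_words X"
  shows "eval_word G f (u @ v) = eval_word G f u \<otimes> eval_word G f v"
  using assms(2)
proof (induction u)
  case Nil
  then show ?case using eval_word_closed[OF f v] by simp
next
  case (Cons p u)
  obtain x b where p: "p = (x, b)" by fastforce
  have x: "f x \<in> carrier G" and u: "u \<in> group_words X"
    using Cons.prems f by (auto simp: group_words_def p)
  show ?case
    using Cons.IH[OF u] x eval_word_closed[OF f u] eval_word_closed[OF f v]
    by (simp add: p m_assoc)
qed

lemma eval_word_pres_cong:
  assumes f: "f \<in> X \<rightarrow> carrier G"
    and R: "\<And>u v. (u, v) \<in> R \<Longrightarrow> u \<in> group_words X \<Longrightarrow> v \<in> group_words X
              \<Longrightarrow> eval_word G f u = eval_word G f v"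
    and "pres_cong X R u v"
  shows "eval_word G f u = eval_word G f v"
  using assms(3)
proof (induction rule: pres_cong.induct)
  case (append u u' v v')
  then show ?case
    using eval_word_append[OF f] pres_cong_words by metis
next
  case (cancel x b)
  then have "f x \<in> carrier G" using f by blast
  then show ?case by simp
qed (auto intro: R)

text \<open>
  Evaluation is constant on congruence classes, so the homomorphism may be read off from any
  representative; the proof takes the one chosen by Hilbert's operator.
\<close>

lemma presented_group_universal:
  assumes f: "f \<in> X \<rightarrow> carrier G"
    and R: "\<And>u v. (u, v) \<in> R \<Longrightarrow> u \<in> group_words X \<Longrightarrow> v \<in> group_words X
              \<Longrightarrow> eval_word G f u = eval_word G f v"
  obtains h where "h \<in> hom (presented_group X R) G"
    and "\<And>x. x \<in> X \<Longrightarrow> h (pres_class X R [pos x]) = f x"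
proof
  define h where "h P = eval_word G f (SOME u. u \<in> P)" for P
  have h_class: "h (pres_class X R w) = eval_word G f w" if w: "w \<in> group_words X" for w
  proof -
    have "w \<in> pres_class X R w"
      using w by (auto simp: pres_class_def pres_rel_def intro: pres_cong.refl)
    then have "(SOME u. u \<in> pres_class X R w) \<in> pres_class X R w"
      by (rule someI)
    then have "pres_cong X R w (SOME u. u \<in> pres_class X R w)"
      by (simp add: pres_class_def pres_rel_def)
    then show ?thesis
      unfolding h_def using eval_word_pres_cong[OF f R] by metis
  qed
  show "h \<in> hom (presented_group X R) G"
    using f by (intro homI)
      (auto simp: carrier_presented_group mult_presented_group h_class append_group_words
        eval_word_closed eval_word_append)
  fix x assume "x \<in> X"
  then show "h (pres_class X R [pos x]) = f x"
    using f funcset_mem[OF f] by (subst h_class) (auto simp: group_words_def)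
qed

end

text \<open>
  The elements of \<open>G\<close> are generators and the multiplication table of \<open>G\<close> is among the relations, so
  the homomorphism \<open>\<phi>\<close> respects that part of the presentation; only the conjugation relations
  remain as a condition on the images of the stable letters.
\<close>

lemma hnn_extension_universal:
  assumes "group L" and \<phi>: "\<phi> \<in> hom G L" and s: "s \<in> I \<rightarrow> carrier L"
    and conj: "\<And>i a. i \<in> I \<Longrightarrow> a \<in> A i \<Longrightarrow> a \<in> carrier G
                 \<Longrightarrow> inv\<^bsub>L\<^esub> s i \<otimes>\<^bsub>L\<^esub> \<phi> a \<otimes>\<^bsub>L\<^esub> s i = \<phi> a"
  obtains h where "h \<in> hom (hnn_extension G I A) L"
    and "\<And>g. g \<in> carrier G \<Longrightarrow> h (hnn_base G I A g) = \<phi> g"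
    and "\<And>i. i \<in> I \<Longrightarrow> h (hnn_stable G I A i) = s i"
proof -
  interpret L: group L by fact
  have \<phi>_closed: "\<phi> g \<in> carrier L" if "g \<in> carrier G" for g
    using \<phi> that by (rule hom_in_carrier)
  let ?f = "case_sum \<phi> s"
  have f: "?f \<in> hnn_gens G I \<rightarrow> carrier L"
    using \<phi>_closed s by (auto simp: hnn_gens_def)
  have "eval_word L ?f u = eval_word L ?f v"
    if "(u, v) \<in> hnn_rels G I A" "u \<in> group_words (hnn_gens G I)"
      "v \<in> group_words (hnn_gens G I)" for u v
    using that(1) unfolding hnn_rels_def
  proof (elim UnE CollectE exE conjE, goal_cases)
    case (1 g k)
    then show ?case using hom_mult[OF \<phi>] \<phi>_closed by simp
  next
    case (2 i a)
    then have a: "a \<in> carrier G"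
      using that(3) by (auto simp: group_words_def hnn_gens_def)
    have "s i \<in> carrier L" using 2 s by blast
    then show ?case
      using 2 conj[OF _ _ a, of i] \<phi>_closed[OF a] by (simp add: L.m_assoc)
  qed
  then obtain h where "h \<in> hom (presented_group (hnn_gens G I) (hnn_rels G I A)) L"
    and "\<And>x. x \<in> hnn_gens G I
           \<Longrightarrow> h (pres_class (hnn_gens G I) (hnn_rels G I A) [pos x]) = ?f x"
    using L.presented_group_universal[OF f] by metis
  then show thesis
    by (intro that[of h]) (auto simp: hnn_extension_def hnn_base_def hnn_stable_def hnn_gens_def)
qed

section \<open>The stable letters in the HNN-extension\<close>

lemma hnn_stable_closed:
  "i \<in> I \<Longrightarrow> hnn_stable G I A i \<in> carrier (hnn_extension G I A)"
  by (auto simp: hnn_extension_def hnn_stable_def carrier_presented_group group_words_def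
      hnn_gens_def)

lemma hnn_base_conj_stable:
  assumes "i \<in> I" "a \<in> A i" "a \<in> carrier G"
  defines "H \<equiv> hnn_extension G I A" and "t \<equiv> hnn_stable G I A i"
  shows "inv\<^bsub>H\<^esub> t \<otimes>\<^bsub>H\<^esub> hnn_base G I A a \<otimes>\<^bsub>H\<^esub> t = hnn_base G I A a"
proof -
  let ?X = "hnn_gens G I" and ?R = "hnn_rels G I A"
  interpret H: group H unfolding H_def by (rule group_hnn_extension)
  have words: "[neg (Inr i)] \<in> group_words ?X" "[pos (Inr i)] \<in> group_words ?X"
    "[pos (Inl a)] \<in> group_words ?X" "[] \<in> group_words ?X"
    "[neg (Inr i), pos (Inr i)] \<in> group_words ?X"
    "[neg (Inr i), pos (Inl a)] \<in> group_words ?X"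
    "[neg (Inr i), pos (Inl a), pos (Inr i)] \<in> group_words ?X"
    using assms by (auto simp: group_words_def hnn_gens_def)
  have "pres_cong ?X ?R [neg (Inr i), pos (Inr i)] []"
    using pres_cong.cancel[of "Inr i" ?X ?R False] assms(1) by (auto simp: hnn_gens_def)
  then have "pres_class ?X ?R [neg (Inr i)] \<otimes>\<^bsub>H\<^esub> t = \<one>\<^bsub>H\<^esub>"
    using words by (simp add: t_def H_def hnn_stable_def hnn_extension_def
        mult_presented_group one_presented_group pres_class_eq_iff)
  moreover have "t \<in> carrier H" "pres_class ?X ?R [neg (Inr i)] \<in> carrier H"
    using hnn_stable_closed[OF assms(1)] words(1)
    by (auto simp: t_def H_def hnn_extension_def carrier_presented_group)
  ultimately have inv_t: "inv\<^bsub>H\<^esub> t = pres_class ?X ?R [neg (Inr i)]"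
    by (metis H.inv_equality)
  have "([neg (Inr i), pos (Inl a), pos (Inr i)], [pos (Inl a)]) \<in> ?R"
    using assms(1,2) unfolding hnn_rels_def by blast
  then have "pres_cong ?X ?R [neg (Inr i), pos (Inl a), pos (Inr i)] [pos (Inl a)]"
    using words by (intro pres_cong.relation)
  then show ?thesis
    unfolding inv_t using words
    by (simp add: t_def H_def hnn_base_def hnn_stable_def hnn_extension_def
        mult_presented_group pres_class_eq_iff)
qed

section \<open>Left translation of subsets\<close>

context group
begin

lemma left_translation_action:
  "group_action G (Pow (carrier G)) (\<lambda>g. \<lambda>S \<in> Pow (carrier G). g <# S)"
proof -
  let ?E = "Pow (carrier G)"
  have closed: "g <# S \<in> ?E" if "g \<in> carrier G" "S \<in> ?E" for g S
    using that l_coset_subset_G by blast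
  have bij: "(\<lambda>S \<in> ?E. g <# S) \<in> Bij ?E" if g: "g \<in> carrier G" for g
  proof -
    have "bij_betw (\<lambda>S \<in> ?E. g <# S) ?E ?E"
      using g by (intro bij_betw_byWitness[where f' = "\<lambda>S. inv g <# S"])
        (simp_all add: lcos_m_assoc lcos_mult_one image_subset_iff closed[simplified])
    then show ?thesis by (simp add: Bij_def)
  qed
  have "(\<lambda>S \<in> ?E. (g \<otimes> k) <# S) = compose ?E (\<lambda>S \<in> ?E. g <# S) (\<lambda>S \<in> ?E. k <# S)"
    if "g \<in> carrier G" "k \<in> carrier G" for g k
    using that closed by (auto simp: compose_def restrict_def fun_eq_iff lcos_m_assoc)
  then have "(\<lambda>g. \<lambda>S \<in> ?E. g <# S) \<in> hom G (BijGroup ?E)"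
    using bij by (intro homI) (auto simp: BijGroup_def)
  then show ?thesis
    by (intro group_action.intro group_hom.intro group_hom_axioms.intro is_group group_BijGroup)
qed

lemma stabilizer_left_translation:
  assumes J: "subgroup J G"
  shows "stabilizer G (\<lambda>g. \<lambda>S \<in> Pow (carrier G). g <# S) J = J"
proof -
  have "g \<in> J" if "g \<in> carrier G" "g <# J = J" for g
    using that subgroup.one_closed[OF J] by (force simp: l_coset_def)
  then show ?thesis
    using subgroup.subset[OF J] coset_join3[OF _ J] by (auto simp: stabilizer_def)
qed

end

lemma (in group_action) conj_mem_stabilizer:
  assumes "x \<in> E" "y \<in> carrier G" "g \<in> stabilizer G \<phi> (\<phi> y x)"
  shows "inv y \<otimes> g \<otimes> y \<in> stabilizer G \<phi> x"
proof -
  interpret group G using group_hom by (rule group_hom.axioms(1))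
  have g: "g \<in> carrier G" "\<phi> g (\<phi> y x) = \<phi> y x"
    using assms(3) by (auto simp: stabilizer_def)
  have "\<phi> y x \<in> E" using assms(1,2) element_image by blast
  then have "\<phi> (inv y \<otimes> g \<otimes> y) x = \<phi> (inv y) (\<phi> y x)"
    using assms(1,2) g by (simp add: composition_rule)
  also have "\<dots> = x" using assms(1,2) orbit_sym_aux by blast
  finally show ?thesis using assms(2) g by (simp add: stabilizer_def)
qed

section \<open>The action of the HNN-extension\<close>

text \<open>
  An element of \<open>A i\<close> lies in \<open>J\<close>, so its left translation fixes the two points \<open>J\<close> and \<open>{}\<close> and
  therefore commutes with the transposition of these points; the stable letters may thus act as
  that transposition.  Working with all subsets of \<open>G\<close> instead of only the cosets of \<open>J\<close> supplies
  the point \<open>{}\<close> fixed by \<open>G\<close> without adjoining a new element.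
\<close>

lemma hnn_action_transposing_base_point:
  assumes "group G" and J: "subgroup J G" and A: "\<And>i. i \<in> I \<Longrightarrow> A i \<subseteq> J"
  obtains h where "group_action (hnn_extension G I A) (Pow (carrier G)) h"
    and "\<And>g S. g \<in> carrier G \<Longrightarrow> S \<subseteq> carrier G \<Longrightarrow> h (hnn_base G I A g) S = g <#\<^bsub>G\<^esub> S"
    and "\<And>i. i \<in> I \<Longrightarrow> h (hnn_stable G I A i) J = {}"
proof -
  interpret group G by fact
  let ?E = "Pow (carrier G)"
  let ?\<phi> = "\<lambda>g. \<lambda>S \<in> ?E. g <#\<^bsub>G\<^esub> S"
  let ?\<tau> = "\<lambda>S \<in> ?E. transpose J {} S"
  interpret act: group_action G ?E ?\<phi> by (rule left_translation_action)
  interpret B: group "BijGroup ?E" by (rule group_BijGroup)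
  have J_E: "J \<in> ?E" using subgroup.subset[OF J] by blast
  have \<tau>: "?\<tau> \<in> carrier (BijGroup ?E)"
    using J_E by (auto simp: BijGroup_def Bij_def)
  have commute: "?\<tau> \<otimes>\<^bsub>BijGroup ?E\<^esub> ?\<phi> a = ?\<phi> a \<otimes>\<^bsub>BijGroup ?E\<^esub> ?\<tau>" if a: "a \<in> J" for a
  proof -
    have aG: "a \<in> carrier G" using a subgroup.subset[OF J] by blast
    have aJ: "a <#\<^bsub>G\<^esub> J = J" using coset_join3[OF aG J a] .
    have a0: "a <#\<^bsub>G\<^esub> {} = {}" by (simp add: l_coset_def)
    have closed: "a <#\<^bsub>G\<^esub> S \<in> ?E" "transpose J {} S \<in> ?E" if "S \<in> ?E" for S
      using that J_E l_coset_subset_G[OF _ aG] by (auto simp: transpose_def)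
    \<comment> \<open>Translation by \<open>a\<close> is injective, so a subset other than \<open>J\<close> and \<open>{}\<close> is sent neither to
      \<open>J\<close> nor to \<open>{}\<close>, and the transposition ignores it before and after.\<close>
    have cancel: "S = T" if "a <#\<^bsub>G\<^esub> S = a <#\<^bsub>G\<^esub> T" "S \<in> ?E" "T \<in> ?E" for S T
      using act.inj_prop[OF aG] that by (auto dest: inj_onD)
    have "transpose J {} (a <#\<^bsub>G\<^esub> S) = a <#\<^bsub>G\<^esub> transpose J {} S" if "S \<in> ?E" for S
    proof -
      have "a <#\<^bsub>G\<^esub> S = J \<longleftrightarrow> S = J" "a <#\<^bsub>G\<^esub> S = {} \<longleftrightarrow> S = {}"
        using cancel[of S J] cancel[of S "{}"] that J_E aJ a0 by auto
      then show ?thesis using aJ a0 by (simp add: transpose_def)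
    qed
    then have "compose ?E ?\<tau> (?\<phi> a) = compose ?E (?\<phi> a) ?\<tau>"
      using closed by (auto simp: compose_def restrict_def fun_eq_iff)
    then show ?thesis
      using \<tau> act.bij_prop0[OF aG] by (simp add: BijGroup_def)
  qed
  have conj: "inv\<^bsub>BijGroup ?E\<^esub> ?\<tau> \<otimes>\<^bsub>BijGroup ?E\<^esub> ?\<phi> a \<otimes>\<^bsub>BijGroup ?E\<^esub> ?\<tau> = ?\<phi> a"
    if "i \<in> I" "a \<in> A i" "a \<in> carrier G" for i a
  proof -
    have "?\<phi> a \<in> carrier (BijGroup ?E)"
      using act.group_hom that(3) by (rule group_hom.hom_closed)
    moreover have "a \<in> J" using A that by blast
    ultimately show ?thesis
      using \<tau> commute[of a] by (metis B.inv_closed B.inv_solve_left B.m_assoc B.m_closed)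
  qed
  obtain h where h: "h \<in> hom (hnn_extension G I A) (BijGroup ?E)"
    and base: "\<And>g. g \<in> carrier G \<Longrightarrow> h (hnn_base G I A g) = ?\<phi> g"
    and stable: "\<And>i. i \<in> I \<Longrightarrow> h (hnn_stable G I A i) = ?\<tau>"
    using hnn_extension_universal[OF B.is_group
        group_hom.homh[OF act.group_hom], of "\<lambda>_. ?\<tau>" I A] \<tau> conj
    by blast
  show thesis
  proof
    show "group_action (hnn_extension G I A) ?E h"
      using h by (intro group_action.intro group_hom.intro group_hom_axioms.intro
          group_hnn_extension group_BijGroup)
  qed (use base stable J_E in auto)
qed

theorem lemma4p4:
  fixes G :: "('a, 'm) monoid_scheme" and r :: nat and A :: "nat \<Rightarrow> 'a set"
  assumes "group G"
    and "\<And>i. i \<in> {1..r} \<Longrightarrow> subgroup (A i) G"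
  defines "H \<equiv> hnn_extension G {1..r} A"
    and "\<iota> \<equiv> hnn_base G {1..r} A"
    and "t \<equiv> hnn_stable G {1..r} A"
  shows "\<iota> ` carrier G \<inter> generate H (\<Union>i\<in>{1..r}. conj_set H (\<iota> ` carrier G) (t i))
       = \<iota> ` generate G (\<Union>i\<in>{1..r}. A i)"
proof -
  interpret G: group G by fact
  interpret H: group H unfolding H_def by (rule group_hnn_extension)
  interpret \<iota>: group_hom G H \<iota>
    using hnn_base_hom[OF assms(1)] unfolding H_def \<iota>_def
    by (intro group_hom.intro group_hom_axioms.intro assms(1) group_hnn_extension)
  define U where "U = (\<Union>i\<in>{1..r}. A i)"
  define J where "J = generate G U"
  define C where "C = (\<Union>i\<in>{1..r}. conj_set H (\<iota> ` carrier G) (t i))"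
  have A_sub: "A i \<subseteq> carrier G" if "i \<in> {1..r}" for i
    using assms(2)[OF that] by (rule subgroup.subset)
  then have U: "U \<subseteq> carrier G" unfolding U_def by blast
  then have J: "subgroup J G" unfolding J_def by (rule G.generate_is_subgroup)
  have t: "t i \<in> carrier H" if "i \<in> {1..r}" for i
    using that unfolding t_def H_def by (rule hnn_stable_closed)
  have "\<iota> ` U \<subseteq> C"
  proof
    fix y assume "y \<in> \<iota> ` U"
    then obtain i a where ia: "i \<in> {1..r}" "a \<in> A i" "y = \<iota> a" by (auto simp: U_def)
    have a: "a \<in> carrier G" using A_sub ia by blast
    have "y = inv\<^bsub>H\<^esub> t i \<otimes>\<^bsub>H\<^esub> \<iota> a \<otimes>\<^bsub>H\<^esub> t i"
      unfolding ia(3) \<iota>_def H_def t_def using hnn_base_conj_stable[where A=A, OF ia(1,2) a] by simp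
    then show "y \<in> C" using ia(1) a unfolding C_def conj_set_def by blast
  qed
  then have "\<iota> ` J \<subseteq> generate H C"
    unfolding J_def \<iota>.generate_img[OF U, symmetric] by (rule H.mono_generate)
  moreover have "\<iota> ` J \<subseteq> \<iota> ` carrier G"
    using subgroup.subset[OF J] by (rule image_mono)
  moreover have "g \<in> J" if g: "g \<in> carrier G" "\<iota> g \<in> generate H C" for g
  proof -
    have "A i \<subseteq> J" if "i \<in> {1..r}" for i
      using that unfolding J_def U_def by (blast intro: generate.incl)
    then obtain h where h: "group_action H (Pow (carrier G)) h"
      and base: "\<And>g S. g \<in> carrier G \<Longrightarrow> S \<subseteq> carrier G \<Longrightarrow> h (\<iota> g) S = g <#\<^bsub>G\<^esub> S"
      and stable: "\<And>i. i \<in> {1..r} \<Longrightarrow> h (t i) J = {}"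
      using hnn_action_transposing_base_point[OF assms(1) J, of "{1..r}" A]
      unfolding H_def \<iota>_def t_def by metis
    interpret h: group_action H "Pow (carrier G)" h by (rule h)
    have J_sub: "J \<in> Pow (carrier G)" using subgroup.subset[OF J] by blast
    have "C \<subseteq> stabilizer H h J"
    proof
      fix y assume "y \<in> C"
      then obtain i k where i: "i \<in> {1..r}" and k: "k \<in> carrier G"
        and y: "y = inv\<^bsub>H\<^esub> t i \<otimes>\<^bsub>H\<^esub> \<iota> k \<otimes>\<^bsub>H\<^esub> t i"
        unfolding C_def conj_set_def by blast
      \<comment> \<open>The stable letter moves \<open>J\<close> to \<open>{}\<close>, and every translation fixes \<open>{}\<close>.\<close>
      have "\<iota> k \<in> stabilizer H h (h (t i) J)"
        unfolding stable[OF i] using k by (simp add: stabilizer_def base l_coset_def)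
      then show "y \<in> stabilizer H h J"
        unfolding y by (rule h.conj_mem_stabilizer[OF J_sub t[OF i]])
    qed
    then have "generate H C \<subseteq> stabilizer H h J"
      using h.stabilizer_subgroup[OF J_sub] by (rule H.generate_subgroup_incl)
    then have "g <#\<^bsub>G\<^esub> J = J"
      using g base subgroup.subset[OF J] by (auto simp: stabilizer_def)
    then show "g \<in> J"
      using g(1) J_sub G.stabilizer_left_translation[OF J] by (auto simp: stabilizer_def)
  qed
  ultimately show ?thesis unfolding C_def J_def U_def by blast
qed

end
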